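(* Let $d\in\mathbb{N}$, let $R,S$ be finite subsets of $\mathbb{Z}^d\setminus\{\mathbf 0\}$, let $(\phi_{\mathbf n})_{\mathbf n\in R},(\theta_{\mathbf n})_{\mathbf n\in S}\subset\mathbb{C}$, and let $(Z_{\mathbf t})_{\mathbf t\in\mathbb{Z}^d}$ be an i.i.d. complex-valued random field. Suppose that $\Phi(e^{-i\mathbf t})\neq 0$ for all $\mathbf t\in\mathbb{T}^d$. Then for appropriate $\mathbf r=(r_1,\dots,r_d)$ and $\boldsymbol\rho=(\rho_1,\dots,\rho_d)$ with $0\le r_i<1<\rho_i$, $i=1,\dots,d$, there exists a Laurent expansion $$\frac{\Theta(\mathbf z)}{\Phi(\mathbf z)}=\sum_{\mathbf k\in\mathbb{Z}^d}\psi_{\mathbf k}\mathbf z^{\mathbf k},\qquad \mathbf z\in K(\mathbf r,\boldsymbol\rho):=\{\mathbf z\in\mathbb{C}^d:\ r_i<|z_i|<\rho_i,\ i=1,\dots,d\}.$$ If further $\mathbb{E}\log_+^d|Z_{\mathbf 0}|<\infty$, then $$Y_{\mathbf t}:=\sum_{\mathbf k\in\mathbb{Z}^d}\psi_{\mathbf k}Z_{\mathbf t-\mathbf k},\qquad \mathbf t\in\mathbb{Z}^d,$$ converges almost surely absolutely. In particular, the random field $(Y_{\mathbf t})_{\mathbf t\in\mathbb{Z}^d}$ solves the ARMA equation $$Y_{\mathbf t}-\sum_{\mathbf n\in R}\phi_{\mathbf n}Y_{\mathbf t-\mathbf n}=Z_{\mathbf t}+\sum_{\mathbf n\in S}\theta_{\mathbf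 n}Z_{\mathbf t-\mathbf n},\qquad \mathbf t\in\mathbb{Z}^d.$$
   Context: Notation: $\mathbf z^{\mathbf n}=z_1^{n_1}\cdots z_d^{n_d}$, $e^{-i\mathbf t}=(e^{-it_1},\dots,e^{-it_d})$, $\mathbb{T}=\mathbb{R}/2\pi\mathbb{Z}$. The autoregressive and moving average polynomials are $\Phi(\mathbf z)=1-\sum_{\mathbf n\in R}\phi_{\mathbf n}\mathbf z^{\mathbf n}$ and $\Theta(\mathbf z)=1+\sum_{\mathbf n\in S}\theta_{\mathbf n}\mathbf z^{\mathbf n}$ (negative exponents are allowed). For $z\ge 0$, $\log_+(z):=\max(\log z,0)$ (with $\log_+(0)=0$), and $\log_+^d(z)=(\log_+ z)^d$. *)

theory Defs
  imports "HOL-Probability.Probability"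
begin

definition mono_pow :: "complex ^ 'd \<Rightarrow> int ^ 'd \<Rightarrow> complex" where
  "mono_pow z n = (\<Prod>i\<in>UNIV. (z $ i) powi (n $ i))"

definition exp_neg_i :: "real ^ 'd \<Rightarrow> complex ^ 'd" where
  "exp_neg_i t = (\<chi> i. exp (- \<i> * of_real (t $ i)))"

definition ar_poly :: "(int ^ 'd) set \<Rightarrow> (int ^ 'd \<Rightarrow> complex) \<Rightarrow> complex ^ 'd \<Rightarrow> complex" where
  "ar_poly R \<phi> z = 1 - (\<Sum>n\<in>R. \<phi> n * mono_pow z n)"

definition ma_poly :: "(int ^ 'd) set \<Rightarrow> (int ^ 'd \<Rightarrow> complex) \<Rightarrow> complex ^ 'd \<Rightarrow> complex" where
  "ma_poly S \<theta> z = 1 + (\<Sum>n\<in>S. \<theta> n * mono_pow z n)"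

definition polyannulus :: "real ^ 'd \<Rightarrow> real ^ 'd \<Rightarrow> (complex ^ 'd) set" where
  "polyannulus r \<rho> = {z. \<forall>i. r $ i < cmod (z $ i) \<and> cmod (z $ i) < \<rho> $ i}"

text \<open>An unordered sum of complex numbers converges iff it converges absolutely, so
  \<open>has_sum\<close> is the usual convergence of a multivariate Laurent series. The denominator is
  required not to vanish because division by zero is total in HOL.\<close>

definition quotient_laurent_on ::
  "(complex ^ 'd) set \<Rightarrow> (complex ^ 'd \<Rightarrow> complex) \<Rightarrow> (complex ^ 'd \<Rightarrow> complex) \<Rightarrow> (int ^ 'd \<Rightarrow> complex) \<Rightarrow> bool"
where
  "quotient_laurent_on K f g \<psi> \<longleftrightarrow>
     (\<forall>z\<in>K. g z \<noteq> 0 \<and> ((\<lambda>k. \<psi> k * mono_pow z k) has_sum (f z / g z)) UNIV)"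

definition log_plus :: "real \<Rightarrow> real" where
  "log_plus x = (if x > 0 then max (ln x) 0 else 0)"

definition iid_field :: "'w measure \<Rightarrow> (int ^ 'd \<Rightarrow> 'w \<Rightarrow> complex) \<Rightarrow> bool" where
  "iid_field M Z \<longleftrightarrow>
     prob_space.indep_vars M (\<lambda>_. borel) Z UNIV \<and>
     (\<forall>t. distr M borel (Z t) = distr M borel (Z 0))"

text \<open>The value at sample points where the series diverges is 0, by the convention for
  \<open>infsum\<close>.\<close>

definition linear_field ::
  "(int ^ 'd \<Rightarrow> complex) \<Rightarrow> (int ^ 'd \<Rightarrow> 'w \<Rightarrow> complex) \<Rightarrow> int ^ 'd \<Rightarrow> 'w \<Rightarrow> complex" where
  "linear_field \<psi> Z t \<omega> = (\<Sum>\<^sub>\<infinity>k\<in>UNIV. \<psi> k * Z (t - k) \<omega>)"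

definition arma_solution ::
  "'w measure \<Rightarrow> (int ^ 'd) set \<Rightarrow> (int ^ 'd \<Rightarrow> complex) \<Rightarrow> (int ^ 'd) set \<Rightarrow> (int ^ 'd \<Rightarrow> complex)
    \<Rightarrow> (int ^ 'd \<Rightarrow> 'w \<Rightarrow> complex) \<Rightarrow> (int ^ 'd \<Rightarrow> 'w \<Rightarrow> complex) \<Rightarrow> bool"
where
  "arma_solution M R \<phi> S \<theta> Z Y \<longleftrightarrow>
     (\<forall>t. Y t \<in> borel_measurable M) \<and>
     (\<forall>t. AE \<omega> in M.
        Y t \<omega> - (\<Sum>n\<in>R. \<phi> n * Y (t - n) \<omega>) = Z t \<omega> + (\<Sum>n\<in>S. \<theta> n * Z (t - n) \<omega>))"

end

theory Submission
  imports Defs "HOL-Library.Poly_Mapping" "HOL-Library.Real_Mod" "HOL-Real_Asymp.Real_Asymp"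
begin

text \<open>
  On the torus \<open>\<bar>\<Phi>\<bar>\<^sup>2\<close> agrees with the Laurent polynomial
  \<open>\<Phi> \<Phi>*\<close>, where \<open>\<Phi>*\<close> has the conjugated coefficients at the negated exponents. If
  \<open>0 < m \<le> \<bar>\<Phi>\<bar>\<^sup>2 \<le> C\<close> there, then \<open>Q = 1 - \<Phi> \<Phi>* / C\<close> satisfies \<open>\<bar>Q\<bar> \<le> q < 1\<close> on the torus, so the
  coefficients of \<open>Q ^ k\<close> are at most \<open>q ^ k\<close>, while their exponents lie in a ball of radius
  \<open>O(k)\<close>. Hence the coefficients of \<open>\<Sum>k. Q ^ k\<close> decay exponentially, and
  \<open>\<psi> = \<Theta> (\<Phi>* / C) (\<Sum>k. Q ^ k)\<close> solves \<open>\<Phi> \<psi> = \<Theta>\<close> as an identity of coefficients.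

  A Laurent polynomial acts on functions on the lattice by \<open>shift_op\<close>. Whenever the series
  \<open>Y t = (\<Sum>k. \<psi> k * x (t - k))\<close> converges absolutely, \<open>\<Phi> \<psi> = \<Theta>\<close> gives
  \<open>shift_op \<Phi> Y = shift_op \<Theta> x\<close>. For \<open>x n = mono_pow z (- n)\<close> this is the Laurent expansion, for
  \<open>x = Z\<close> it is the ARMA equation.
\<close>

section \<open>Laurent polynomials as operators\<close>

abbreviation lmonom :: "'a \<Rightarrow> 'b::zero \<Rightarrow> ('a \<Rightarrow>\<^sub>0 'b)" where
  "lmonom \<equiv> Poly_Mapping.single"

abbreviation lsupp :: "('a \<Rightarrow>\<^sub>0 'b::zero) \<Rightarrow> 'a set" where
  "lsupp \<equiv> Poly_Mapping.keys"

abbreviation lcoeff :: "('a \<Rightarrow>\<^sub>0 'b::zero) \<Rightarrow> 'a \<Rightarrow> 'b" where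
  "lcoeff \<equiv> Poly_Mapping.lookup"

text \<open>Finitely supported functions are finite sums of monomials. The additive step asks for no
  disjointness of supports, so any property that passes to sums reduces to the case of one
  monomial.\<close>

lemma plus_single_induct [case_names single add]:
  fixes p :: "'a \<Rightarrow>\<^sub>0 'b::comm_monoid_add"
  assumes single: "\<And>m c. P (lmonom m c)" and add: "\<And>p q. P p \<Longrightarrow> P q \<Longrightarrow> P (p + q)"
  shows "P p"
proof (induction p rule: update_induct)
  case const
  then show ?case using single[of undefined 0] by simp
next
  case (update p m c)
  have "Poly_Mapping.update m c p = p + lmonom m c"
    using update(1) by (intro poly_mapping_eqI)
      (auto simp: Poly_Mapping.lookup_update lookup_add lookup_single in_keys_iff)
  then show ?case using update.IH single add by auto
qed

text \<open>Convolution of \<open>p\<close> with \<open>f\<close>. Since \<open>p\<close> has finite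
  support, \<open>f\<close> may be any function on the group: an infinite coefficient array, a path
  of the random field, or a character.\<close>

definition shift_op :: "('g::ab_group_add \<Rightarrow>\<^sub>0 'a::comm_ring_1) \<Rightarrow> ('g \<Rightarrow> 'a) \<Rightarrow> 'g \<Rightarrow> 'a" where
  "shift_op p f n = (\<Sum>m\<in>lsupp p. lcoeff p m * f (n - m))"

lemma shift_op_superset:
  assumes "finite A" "lsupp p \<subseteq> A"
  shows "shift_op p f n = (\<Sum>m\<in>A. lcoeff p m * f (n - m))"
  unfolding shift_op_def using assms
  by (intro sum.mono_neutral_left) (auto simp: in_keys_iff)

lemma shift_op_single [simp]: "shift_op (lmonom m c) f n = c * f (n - m)"
  by (subst shift_op_superset[of "{m}"]) auto

lemma shift_op_one [simp]: "shift_op 1 f = f"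
  by (rule ext) (simp flip: single_one)

lemma shift_op_zero [simp]: "shift_op 0 f n = 0"
  by (simp add: shift_op_def)

lemma shift_op_add: "shift_op (p + q) f n = shift_op p f n + shift_op q f n"
proof -
  have *: "finite (lsupp p \<union> lsupp q)" "lsupp (p + q) \<subseteq> lsupp p \<union> lsupp q"
    "lsupp p \<subseteq> lsupp p \<union> lsupp q" "lsupp q \<subseteq> lsupp p \<union> lsupp q"
    using keys_add[of p q] by auto
  show ?thesis
    unfolding shift_op_superset[OF *(1,2)] shift_op_superset[OF *(1,3)] shift_op_superset[OF *(1,4)]
    by (simp add: lookup_add algebra_simps sum.distrib)
qed

lemma shift_op_diff: "shift_op (p - q) f n = shift_op p f n - shift_op q f n"
  using shift_op_add[of "p - q" q f n] by (simp add: algebra_simps)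

lemma shift_op_sum: "shift_op (\<Sum>i\<in>I. p i) f n = (\<Sum>i\<in>I. shift_op (p i) f n)"
  by (induction I rule: infinite_finite_induct) (auto simp: shift_op_add)

lemma shift_op_mult_right: "shift_op p (\<lambda>n. f n * c) n = shift_op p f n * c"
  by (simp add: shift_op_def sum_distrib_right mult.assoc)

text \<open>Functions on the group thus form a module over the ring of Laurent polynomials. The
  product rules for coefficients and for values are both derived from this action.\<close>

lemma shift_op_mult: "shift_op (p * q) f = shift_op p (shift_op q f)"
proof (induction p rule: plus_single_induct)
  case (single m c)
  show ?case
  proof (induction q rule: plus_single_induct)
    case (single k d)
    then show ?case by (auto simp: mult_single algebra_simps fun_eq_iff)
  next
    case (add q1 q2)
    then show ?case by (simp add: fun_eq_iff distrib_left shift_op_add)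
  qed
next
  case (add p1 p2)
  then show ?case by (simp add: fun_eq_iff distrib_right shift_op_add)
qed

text \<open>\<open>lcoeff 1\<close> is the unit mass at \<open>0\<close>, the neutral element of
  convolution.\<close>

lemma lookup_eq_shift_op: "lcoeff p n = shift_op p (lcoeff 1) n"
  by (induction p rule: plus_single_induct)
    (auto simp: lookup_single lookup_one when_def shift_op_add lookup_add)

lemma lookup_mult_shift_op: "lcoeff (p * q) = shift_op p (lcoeff q)"
proof
  have "shift_op q (lcoeff 1) = lcoeff q"
    by (simp add: fun_eq_iff flip: lookup_eq_shift_op)
  then show "lcoeff (p * q) n = shift_op p (lcoeff q) n" for n
    by (simp add: lookup_eq_shift_op[of "p * q"] shift_op_mult)
qed

section \<open>Evaluation of Laurent polynomials\<close>

definition leval :: "complex ^ 'd \<Rightarrow> ((int ^ 'd) \<Rightarrow>\<^sub>0 complex) \<Rightarrow> complex" where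
  "leval z p = (\<Sum>m\<in>lsupp p. lcoeff p m * mono_pow z m)"

lemma mono_pow_0 [simp]: "mono_pow z 0 = 1"
  by (simp add: mono_pow_def)

lemma mono_pow_add: "(\<And>i. z $ i \<noteq> 0) \<Longrightarrow> mono_pow z (m + n) = mono_pow z m * mono_pow z n"
  by (simp add: mono_pow_def power_int_add prod.distrib)

text \<open>The characters \<open>n \<mapsto> mono_pow z (- n)\<close> are eigenfunctions of every
  \<open>shift_op p\<close>, with eigenvalue \<open>leval z p\<close>. Through them, identities
  between operators become identities between values.\<close>

lemma shift_op_mono_pow:
  assumes "\<And>i. z $ i \<noteq> 0"
  shows "shift_op p (\<lambda>n. mono_pow z (- n)) n = leval z p * mono_pow z (- n)"
  unfolding shift_op_def leval_def sum_distrib_right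
  by (intro sum.cong) (auto simp: mono_pow_add[OF assms, symmetric])

lemma leval_eq_shift_op:
  assumes "\<And>i. z $ i \<noteq> 0"
  shows "leval z p = shift_op p (\<lambda>n. mono_pow z (- n)) 0"
  using shift_op_mono_pow[OF assms, of p 0] by simp

lemma leval_mult:
  assumes "\<And>i. z $ i \<noteq> 0"
  shows "leval z (p * q) = leval z p * leval z q"
proof -
  have "leval z (p * q) = shift_op p (\<lambda>n. mono_pow z (- n) * leval z q) 0"
    unfolding leval_eq_shift_op[OF assms, of "p * q"] shift_op_mult shift_op_mono_pow[OF assms]
    by (simp add: mult.commute)
  then show ?thesis
    by (simp add: shift_op_mult_right leval_eq_shift_op[OF assms, of p])
qed

lemma leval_single [simp]: "leval z (lmonom m c) = c * mono_pow z m"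
  by (simp add: leval_def)

lemma leval_add: "leval z (p + q) = leval z p + leval z q"
  unfolding leval_def by (rule setsum_keys_plus_distrib) (auto simp: algebra_simps)

lemma leval_sum: "leval z (\<Sum>i\<in>I. p i) = (\<Sum>i\<in>I. leval z (p i))"
  by (induction I rule: infinite_finite_induct) (auto simp: leval_add leval_def[of z 0])

lemma leval_one [simp]: "leval z 1 = 1"
  by (simp flip: single_one)

lemma leval_diff: "leval z (p - q) = leval z p - leval z q"
  using leval_add[of z "p - q" q] by (simp add: algebra_simps)

lemma leval_power:
  assumes "\<And>i. z $ i \<noteq> 0"
  shows "leval z (p ^ k) = leval z p ^ k"
  by (induction k) (auto simp: leval_mult[OF assms])

section \<open>Size of exponents and lattice point counts\<close>

definition l1 :: "int ^ 'd \<Rightarrow> nat" where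
  "l1 n = (\<Sum>i\<in>UNIV. nat \<bar>n $ i\<bar>)"

lemma l1_0 [simp]: "l1 0 = 0"
  by (simp add: l1_def)

lemma l1_uminus [simp]: "l1 (- n) = l1 n"
  by (simp add: l1_def)

lemma l1_triangle: "l1 (m + n) \<le> l1 m + l1 n"
  unfolding l1_def sum.distrib[symmetric] by (intro sum_mono) auto

lemma norm_mono_pow_le:
  assumes "\<And>i. 1 / s \<le> cmod (z $ i)" "\<And>i. cmod (z $ i) \<le> s" "1 \<le> s"
  shows "cmod (mono_pow z n) \<le> s ^ l1 n"
proof -
  have "cmod (z $ i powi (n $ i)) \<le> s ^ nat \<bar>n $ i\<bar>" for i
  proof (cases "n $ i \<ge> 0")
    case True
    then show ?thesis using assms by (auto simp: power_int_def norm_power intro!: power_mono)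
  next
    case False
    have "0 < 1 / s" using assms(3) by auto
    then have "0 < cmod (z $ i)" using assms(1)[of i] by linarith
    then have "inverse (cmod (z $ i)) \<le> s"
      using assms(1)[of i] assms(3) by (simp add: field_simps)
    then have "inverse (cmod (z $ i)) ^ nat \<bar>n $ i\<bar> \<le> s ^ nat \<bar>n $ i\<bar>"
      by (intro power_mono) auto
    then show ?thesis using False by (simp add: power_int_def norm_power norm_inverse)
  qed
  then show ?thesis
    unfolding mono_pow_def l1_def power_sum prod_norm[symmetric] by (intro prod_mono) auto
qed

lemma abs_component_le_l1: "\<bar>n $ i\<bar> \<le> int (l1 (n :: int ^ 'd::finite))"
proof -
  have "nat \<bar>n $ i\<bar> \<le> l1 n"
    unfolding l1_def by (rule member_le_sum) auto
  then show ?thesis by linarith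
qed

lemma l1_ball_subset: "{n :: int ^ 'd::finite. l1 n \<le> m} \<subseteq> vec_lambda ` (UNIV \<rightarrow>\<^sub>E {- int m..int m})"
proof
  fix n :: "int ^ 'd" assume "n \<in> {n. l1 n \<le> m}"
  then have "\<bar>n $ i\<bar> \<le> int m" for i
    using abs_component_le_l1[of n i] by simp
  then have "(\<lambda>i. n $ i) \<in> UNIV \<rightarrow>\<^sub>E {- int m..int m}"
    by (auto simp: abs_le_iff) (metis minus_le_iff)
  then show "n \<in> vec_lambda ` (UNIV \<rightarrow>\<^sub>E {- int m..int m})"
    by (intro image_eqI[of _ _ "\<lambda>i. n $ i"]) auto
qed

lemma finite_l1_ball: "finite {n :: int ^ 'd::finite. l1 n \<le> m}"
  by (rule finite_subset[OF l1_ball_subset]) (auto intro!: finite_imageI finite_PiE)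

lemma card_l1_ball: "card {n :: int ^ 'd::finite. l1 n \<le> m} \<le> (2 * m + 1) ^ CARD('d)"
proof -
  have "card {n :: int ^ 'd. l1 n \<le> m} \<le> card ((UNIV :: 'd set) \<rightarrow>\<^sub>E {- int m..int m})"
    by (rule order_trans[OF card_mono[OF _ l1_ball_subset] card_image_le])
      (auto intro!: finite_imageI finite_PiE)
  also have "\<dots> = (2 * m + 1) ^ CARD('d)"
    by (simp add: card_PiE nat_add_distrib nat_mult_distrib)
  finally show ?thesis .
qed

lemma l1_keys_power:
  fixes p :: "(int ^ 'd::finite) \<Rightarrow>\<^sub>0 complex"
  assumes "\<And>n. n \<in> lsupp p \<Longrightarrow> l1 n \<le> D" "n \<in> lsupp (p ^ k)"
  shows "l1 n \<le> k * D"
  using assms(2)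
proof (induction k arbitrary: n)
  case 0
  then show ?case by simp
next
  case (Suc k)
  then obtain a b where "n = a + b" "a \<in> lsupp p" "b \<in> lsupp (p ^ k)"
    using keys_mult[of p "p ^ k"] by auto
  then show ?case
    using Suc.IH[of b] assms(1)[of a] l1_triangle[of a b] by simp
qed

section \<open>Inversion of Laurent polynomials\<close>

lemma sum_cis_roots:
  fixes m :: int
  assumes "\<bar>m\<bar> < int N"
  shows "(\<Sum>j<N. cis (2 * pi * real j / real N) powi m) = (if m = 0 then of_nat N else 0)"
proof -
  let ?x = "cis (2 * pi * of_int m / real N)"
  have N: "N > 0" using assms by auto
  have eq: "cis (2 * pi * real j / real N) powi m = ?x ^ j" for j
    by (simp add: cis_power_int Complex.DeMoivre mult_ac)
  have pow: "?x ^ N = 1"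
    using N cis_multiple_2pi[of "of_int m"] by (simp add: Complex.DeMoivre)
  show ?thesis
  proof (cases "m = 0")
    case False
    \<comment> \<open>By the bound on \<open>m\<close>, its only possible value among the multiples
      of \<open>N\<close> is \<open>0\<close>. For all other \<open>m\<close> the geometric sum
      therefore has ratio different from 1 and vanishes.\<close>
    have "?x \<noteq> 1"
    proof
      assume "?x = 1"
      then obtain k :: int where "2 * pi * of_int m / real N = of_int k * (2 * pi)"
        by (auto simp: cis_eq_1_iff)
      then have "real_of_int m = of_int (k * int N)"
        using N by (simp add: field_simps)
      then have "m = k * int N" by linarith
      with assms False show False
        by (metis abs_mult abs_of_nat dvd_imp_le_int dvd_triv_right linorder_not_le)
    qed
    then show ?thesis
      using False pow geometric_sum[of ?x N] by (simp add: eq)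
  qed simp
qed

text \<open>A discrete Cauchy estimate: the average over a fine enough grid of roots of unity
  reproduces the constant coefficient exactly, so no integral over the torus is needed.\<close>

lemma norm_coeff_0_le:
  fixes p :: "(int ^ 'd::finite) \<Rightarrow>\<^sub>0 complex"
  assumes "\<And>z. (\<And>i. cmod (z $ i) = 1) \<Longrightarrow> cmod (leval z p) \<le> B"
  shows "cmod (lcoeff p 0) \<le> B"
proof -
  \<comment> \<open>Larger than every \<open>\<bar>m $ i\<bar>\<close> with \<open>m\<close> in the
    support, so that no nonzero exponent is aliased to \<open>0\<close>; \<open>Suc\<close> keeps
    \<open>N\<close> positive.\<close>
  define N where "N = Suc (\<Sum>m\<in>lsupp p. l1 m)"
  define G where "G = (UNIV :: 'd set) \<rightarrow>\<^sub>E {..<N}"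
  define w :: "('d \<Rightarrow> nat) \<Rightarrow> complex ^ 'd"
    where "w g = (\<chi> i. cis (2 * pi * real (g i) / real N))" for g
  have [simp]: "finite G" unfolding G_def by (intro finite_PiE) auto
  have card: "card G = N ^ CARD('d)" by (simp add: G_def card_PiE)
  have *: "(\<Sum>g\<in>G. mono_pow (w g) m) = (if m = 0 then of_nat N ^ CARD('d) else 0)" if "m \<in> lsupp p" for m
  proof -
    have "l1 m \<le> (\<Sum>m\<in>lsupp p. l1 m)" using that by (intro member_le_sum) auto
    then have small: "\<bar>m $ i\<bar> < int N" for i
      using abs_component_le_l1[of m i] unfolding N_def by linarith
    have "(\<Sum>g\<in>G. mono_pow (w g) m) = (\<Prod>i\<in>UNIV. \<Sum>j<N. cis (2 * pi * real j / real N) powi (m $ i))"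
      unfolding G_def by (subst prod_sum_PiE) (auto simp: mono_pow_def w_def)
    also have "\<dots> = (\<Prod>i\<in>UNIV. if m $ i = 0 then of_nat N else 0)"
      by (intro prod.cong refl sum_cis_roots small)
    also have "\<dots> = (if m = 0 then of_nat N ^ CARD('d) else 0)"
    proof (cases "m = 0")
      case False
      then obtain i where "m $ i \<noteq> 0" by (auto simp: vec_eq_iff)
      with False show ?thesis by (auto intro!: prod_zero)
    qed simp
    finally show ?thesis .
  qed
  have "(\<Sum>g\<in>G. leval (w g) p) = (\<Sum>m\<in>lsupp p. lcoeff p m * (\<Sum>g\<in>G. mono_pow (w g) m))"
    unfolding leval_def sum_distrib_left by (rule sum.swap)
  also have "\<dots> = (\<Sum>m\<in>lsupp p. if m = 0 then lcoeff p 0 * of_nat N ^ CARD('d) else 0)"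
    by (intro sum.cong refl) (auto simp: *)
  also have "\<dots> = lcoeff p 0 * of_nat N ^ CARD('d)"
    by (auto simp: in_keys_iff)
  finally have "cmod (lcoeff p 0) * real N ^ CARD('d) = cmod (\<Sum>g\<in>G. leval (w g) p)"
    by (simp add: norm_mult norm_power)
  also have "\<dots> \<le> (\<Sum>g\<in>G. B)"
    by (intro sum_norm_le assms) (auto simp: w_def)
  also have "\<dots> = B * real N ^ CARD('d)"
    by (simp add: card)
  finally have "cmod (lcoeff p 0) * real N ^ CARD('d) \<le> B * real N ^ CARD('d)" .
  moreover have "real N ^ CARD('d) > 0" by (simp add: N_def del: of_nat_Suc)
  ultimately show ?thesis by (rule mult_right_le_imp_le)
qed

lemma norm_mono_pow_torus: "(\<And>i. cmod (z $ i) = 1) \<Longrightarrow> cmod (mono_pow z m) = 1"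
  by (simp add: mono_pow_def norm_power_int flip: prod_norm)

text \<open>Multiplication by the monomial with exponent \<open>- n\<close> moves the coefficient at
  \<open>n\<close> to \<open>0\<close> and leaves the modulus on the torus unchanged.\<close>

lemma norm_coeff_le:
  fixes p :: "(int ^ 'd::finite) \<Rightarrow>\<^sub>0 complex"
  assumes "\<And>z. (\<And>i. cmod (z $ i) = 1) \<Longrightarrow> cmod (leval z p) \<le> B"
  shows "cmod (lcoeff p n) \<le> B"
proof -
  have "cmod (lcoeff (lmonom (- n) 1 * p) 0) \<le> B"
  proof (rule norm_coeff_0_le)
    fix z :: "complex ^ 'd" assume z: "\<And>i. cmod (z $ i) = 1"
    then have "z $ i \<noteq> 0" for i by (metis norm_zero zero_neq_one)
    then show "cmod (leval z (lmonom (- n) 1 * p)) \<le> B"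
      using assms z by (simp add: leval_mult norm_mult norm_mono_pow_torus)
  qed
  then show ?thesis by (simp add: lookup_mult_shift_op)
qed

section \<open>Exponentially weighted summability and the Neumann series\<close>

lemma summable_poly_times_geometric:
  fixes a x :: real and d :: nat
  assumes x: "0 < x" "x < 1" and a: "0 \<le> a"
  shows "summable (\<lambda>k. (a * real k + 1) ^ d * x ^ k)"
proof -
  define h where "h k = (a * real k + 1) ^ d * x ^ k" for k
  define e where "e k = ((a * real (Suc k) + 1) / (a * real k + 1)) ^ d * x" for k
  have h_Suc: "h (Suc k) = e k * h k" for k
  proof -
    have "a * real k + 1 > 0" using a by (simp add: add_nonneg_pos)
    then show ?thesis by (simp add: h_def e_def power_divide)
  qed
  have "(\<lambda>k. (a * real (Suc k) + 1) / (a * real k + 1)) \<longlonglongrightarrow> 1"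
  proof (cases "a = 0")
    case False
    then have "a > 0" using a by simp
    then show ?thesis by real_asymp
  qed simp
  then have "e \<longlonglongrightarrow> 1 ^ d * x"
    unfolding e_def by (intro tendsto_intros)
  \<comment> \<open>The ratio of consecutive terms tends to \<open>x\<close>, and
    \<open>(1 + x) / 2\<close> lies strictly between \<open>x\<close> and 1.\<close>
  then have "eventually (\<lambda>k. e k < (1 + x) / 2) sequentially"
    using x by (intro order_tendstoD) auto
  then obtain N where N: "\<And>k. k \<ge> N \<Longrightarrow> e k < (1 + x) / 2"
    by (auto simp: eventually_sequentially)
  have h: "h k \<ge> 0" for k using a x by (simp add: h_def)
  have "summable h"
  proof (rule summable_ratio_test)
    show "(1 + x) / 2 < 1" using x by simp
    show "norm (h (Suc k)) \<le> (1 + x) / 2 * norm (h k)" if "k \<ge> N" for k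
      using mult_right_mono[OF less_imp_le[OF N[OF that]] h[of k]] h[of k] h[of "Suc k"] by (simp add: h_Suc)
  qed
  then show ?thesis by (simp add: h_def[abs_def])
qed

text \<open>For \<open>s > 1\<close> this encodes exponential decay. The weight dominates all
  monomials on the closed polyannulus with radii \<open>1 / s\<close> and \<open>s\<close>, and also
  any field with finitely many exceedances of \<open>s ^ l1 n\<close>.\<close>

definition wsummable :: "real \<Rightarrow> (int ^ 'd \<Rightarrow> complex) \<Rightarrow> bool" where
  "wsummable s f \<longleftrightarrow> (\<lambda>n. cmod (f n) * s ^ l1 n) summable_on UNIV"

lemma summable_on_shift:
  fixes f :: "'g::ab_group_add \<Rightarrow> 'a::{comm_monoid_add,topological_space}"
  shows "(\<lambda>n. f (n - m)) summable_on UNIV \<longleftrightarrow> f summable_on UNIV"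
  by (rule summable_on_reindex_bij_witness[of UNIV "\<lambda>n. n + m" "\<lambda>n. n - m"]) auto

text \<open>Translation by \<open>m\<close> costs at most the factor \<open>s ^ l1 m\<close>, by the
  triangle inequality for \<open>l1\<close>.\<close>

lemma wsummable_shift_op:
  assumes "1 \<le> s" "wsummable s f"
  shows "wsummable s (shift_op p f)"
proof (induction p rule: plus_single_induct)
  case (single m c)
  have "(\<lambda>n. cmod (f n) * s ^ l1 n * (cmod c * s ^ l1 m)) summable_on UNIV"
    using assms(2) unfolding wsummable_def by (rule summable_on_cmult_left)
  then have "(\<lambda>n. cmod (f (n - m)) * s ^ l1 (n - m) * (cmod c * s ^ l1 m)) summable_on UNIV"
    by (subst summable_on_shift)
  then show ?case
    unfolding wsummable_def
  proof (rule summable_on_comparison_test)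
    fix n
    have "s ^ l1 n \<le> s ^ l1 (n - m) * s ^ l1 m"
      unfolding power_add[symmetric] using assms(1) l1_triangle[of "n - m" m]
      by (intro power_increasing) auto
    then have "cmod (f (n - m)) * cmod c * s ^ l1 n \<le> cmod (f (n - m)) * cmod c * (s ^ l1 (n - m) * s ^ l1 m)"
      by (intro mult_left_mono) auto
    then show "cmod (shift_op (lmonom m c) f n) * s ^ l1 n
        \<le> cmod (f (n - m)) * s ^ l1 (n - m) * (cmod c * s ^ l1 m)"
      by (simp add: norm_mult mult_ac)
  qed (use assms(1) in auto)
next
  case (add p q)
  have "(\<lambda>n. cmod (shift_op p f n) * s ^ l1 n + cmod (shift_op q f n) * s ^ l1 n) summable_on UNIV"
    using add unfolding wsummable_def by (rule summable_on_add)
  then show ?case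
    unfolding wsummable_def
    by (rule summable_on_comparison_test)
      (use assms(1) in \<open>auto simp: shift_op_add norm_triangle_ineq mult_right_mono simp flip: distrib_right\<close>)
qed

text \<open>Associativity of convolution: \<open>p\<close> may act on the coefficients instead of on
  the sums. For a monomial this is a translation of the summation index.\<close>

lemma has_sum_shift_op:
  fixes \<psi> x :: "'g::ab_group_add \<Rightarrow> complex"
  assumes "\<And>t. ((\<lambda>k. \<psi> k * x (t - k)) has_sum Y t) UNIV"
  shows "((\<lambda>k. shift_op p \<psi> k * x (t - k)) has_sum shift_op p Y t) UNIV"
proof (induction p rule: plus_single_induct)
  case (single m c)
  have "((\<lambda>k. c * (\<psi> k * x (t - m - k))) has_sum c * Y (t - m)) UNIV"
    by (intro has_sum_cmult_right assms)
  also have "?this \<longleftrightarrow> ((\<lambda>k. shift_op (lmonom m c) \<psi> k * x (t - k)) has_sum shift_op (lmonom m c) Y t) UNIV"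
    by (rule has_sum_reindex_bij_witness[of UNIV "\<lambda>n. n - m" "\<lambda>n. n + m"]) (auto simp: algebra_simps)
  finally show ?case .
next
  case (add p q)
  then show ?case
    by (auto simp: shift_op_add distrib_right intro: has_sum_add)
qed

lemma has_sum_shift_op_family:
  fixes f :: "'i \<Rightarrow> 'g::ab_group_add \<Rightarrow> complex"
  assumes "\<And>n. ((\<lambda>k. f k n) has_sum F n) A"
  shows "((\<lambda>k. shift_op p (f k) n) has_sum shift_op p F n) A"
  by (induction p rule: plus_single_induct)
    (auto simp: shift_op_add intro: has_sum_add has_sum_cmult_right assms)

lemma has_sum_coeff:
  fixes x :: "'g::ab_group_add \<Rightarrow> complex"
  shows "((\<lambda>k. lcoeff p k * x (t - k)) has_sum shift_op p x t) UNIV"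
  by (rule has_sum_finite_neutralI[of "lsupp p"]) (auto simp: shift_op_def in_keys_iff)

text \<open>\<open>Q ^ k\<close> has at most \<open>(2 * D * k + 1) ^ CARD('d)\<close> coefficients,
  each at most \<open>q ^ k\<close> in modulus and of weight at most \<open>s ^ (k * D)\<close>.
  Once \<open>q * s ^ D < 1\<close>, the weighted norms of the powers are summable.\<close>

lemma neumann_series:
  fixes Q :: "(int ^ 'd::finite) \<Rightarrow>\<^sub>0 complex"
  assumes q: "0 < q" "q < 1"
    and Q: "\<And>z. (\<And>i. cmod (z $ i) = 1) \<Longrightarrow> cmod (leval z Q) \<le> q"
  obtains s b where "1 < s" "wsummable s b" "shift_op (1 - Q) b = lcoeff 1"
proof -
  define D where "D = (\<Sum>m\<in>lsupp Q. l1 m)"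
  \<comment> \<open>Chosen so that \<open>s ^ Suc D = 1 / sqrt q\<close>, which gives
    \<open>x < sqrt q < 1\<close>. The successor keeps the index of the root positive when
    \<open>D = 0\<close>.\<close>
  define s where "s = root (Suc D) (1 / sqrt q)"
  define x where "x = q * s ^ D"
  have s: "1 < s" using q unfolding s_def by (subst real_root_gt_1_iff) auto
  have "s ^ D < s ^ Suc D" using s by (intro power_strict_increasing) auto
  also have "s ^ Suc D = 1 / sqrt q"
    unfolding s_def using q by (intro real_root_pow_pos2) auto
  finally have "x < q / sqrt q" using q by (simp add: x_def field_simps)
  also have "q / sqrt q = sqrt q" using q by (simp add: real_div_sqrt)
  also have "sqrt q < 1" using q by simp
  finally have x: "0 < x" "x < 1" using q s by (auto simp: x_def)

  have bound: "cmod (lcoeff (Q ^ k) n) \<le> q ^ k" for k n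
  proof (rule norm_coeff_le)
    fix z :: "complex ^ 'd" assume z: "\<And>i. cmod (z $ i) = 1"
    then have "z $ i \<noteq> 0" for i by (metis norm_zero zero_neq_one)
    then show "cmod (leval z (Q ^ k)) \<le> q ^ k"
      using Q[OF z] by (simp add: leval_power norm_power power_mono)
  qed
  have D: "l1 n \<le> D" if "n \<in> lsupp Q" for n
    unfolding D_def using that by (intro member_le_sum) auto

  define F where "F = (\<lambda>(k, n). cmod (lcoeff (Q ^ k) n) * s ^ l1 n)"
  define G where "G k = (\<Sum>n\<in>lsupp (Q ^ k). F (k, n))" for k
  have F_sum: "((\<lambda>n. F (k, n)) has_sum G k) UNIV" for k
    by (rule has_sum_finite_neutralI[of "lsupp (Q ^ k)"]) (auto simp: F_def G_def in_keys_iff)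
  have G_le: "G k \<le> real (2 * D * k + 1) ^ CARD('d) * x ^ k" for k
  proof -
    have "G k \<le> (\<Sum>n\<in>lsupp (Q ^ k). q ^ k * s ^ (k * D))"
      unfolding G_def F_def prod.case using s q
      by (intro sum_mono mult_mono bound power_increasing l1_keys_power[OF D]) auto
    also have "\<dots> = real (card (lsupp (Q ^ k))) * x ^ k"
      by (simp add: x_def power_mult_distrib mult.commute[of k] power_mult)
    also have "card (lsupp (Q ^ k)) \<le> card {n :: int ^ 'd. l1 n \<le> k * D}"
      by (intro card_mono finite_l1_ball) (auto intro: l1_keys_power[OF D])
    then have "card (lsupp (Q ^ k)) \<le> (2 * D * k + 1) ^ CARD('d)"
      using card_l1_ball[where 'd='d, of "k * D"] by (simp add: mult_ac)
    then have "real (card (lsupp (Q ^ k))) \<le> real (2 * D * k + 1) ^ CARD('d)"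
      by (metis of_nat_le_iff of_nat_power)
    then have "real (card (lsupp (Q ^ k))) * x ^ k \<le> real (2 * D * k + 1) ^ CARD('d) * x ^ k"
      using x by (intro mult_right_mono) auto
    finally show ?thesis .
  qed
  have F_nonneg: "F y \<ge> 0" for y using s by (auto simp: F_def split: prod.split)
  have G_nonneg: "G k \<ge> 0" for k unfolding G_def by (intro sum_nonneg F_nonneg)
  have "summable G"
    by (rule summable_comparison_test'[OF
          summable_poly_times_geometric[OF x, of "2 * real D" "CARD('d)"], where N = 0])
      (use G_le G_nonneg in \<open>auto simp: add.commute\<close>)
  then have "G summable_on UNIV"
    using G_nonneg by (simp add: summable_on_UNIV_nonneg_real_iff)
  \<comment> \<open>Summability over pairs allows the order to be exchanged: the sums over
    \<open>n\<close> are controlled by \<open>G\<close>, while \<open>b\<close> needs the sums over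
    \<open>k\<close>.\<close>
  then have "F summable_on (UNIV \<times> UNIV)"
    using F_sum F_nonneg by (intro summable_on_SigmaI) auto
  then have F': "(\<lambda>(n, k). F (k, n)) summable_on (UNIV \<times> UNIV)"
    by (subst summable_on_swap) auto
  have Fn: "(\<lambda>k. F (k, n)) summable_on UNIV" for n
    using summable_on_SigmaD1[OF F', of n] F_nonneg by simp
  have coeff_sum: "(\<lambda>k. cmod (lcoeff (Q ^ k) n)) summable_on UNIV" for n
    using summable_on_cmult_left[OF Fn[of n], of "inverse (s ^ l1 n)"] s
    by (simp add: F_def mult.assoc)
  define b where "b n = (\<Sum>\<^sub>\<infinity>k. lcoeff (Q ^ k) n)" for n
  have b: "((\<lambda>k. lcoeff (Q ^ k) n) has_sum b n) UNIV" for n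
    unfolding b_def using abs_summable_summable[OF coeff_sum] by (rule has_sum_infsum)
  have "wsummable s b"
    unfolding wsummable_def
  proof (rule summable_on_comparison_test)
    show "(\<lambda>n. \<Sum>\<^sub>\<infinity>k. F (k, n)) summable_on UNIV"
      using summable_on_Sigma_banach[OF F'] by simp
    show "cmod (b n) * s ^ l1 n \<le> (\<Sum>\<^sub>\<infinity>k. F (k, n))" for n
    proof -
      have "cmod (b n) \<le> (\<Sum>\<^sub>\<infinity>k. cmod (lcoeff (Q ^ k) n))"
        unfolding b_def by (rule norm_infsum_bound[OF coeff_sum])
      then have "cmod (b n) * s ^ l1 n \<le> (\<Sum>\<^sub>\<infinity>k. cmod (lcoeff (Q ^ k) n)) * s ^ l1 n"
        using s by (intro mult_right_mono) auto
      also have "\<dots> = (\<Sum>\<^sub>\<infinity>k. F (k, n))"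
        unfolding F_def by (subst infsum_cmult_left[symmetric]) (use coeff_sum in auto)
      finally show ?thesis .
    qed
  qed (use s in auto)
  moreover have "shift_op (1 - Q) b = lcoeff 1"
  proof
    fix n
    have "((\<lambda>k. shift_op Q (lcoeff (Q ^ k)) n) has_sum shift_op Q b n) UNIV"
      by (intro has_sum_shift_op_family b)
    then have "(\<lambda>k. lcoeff (Q ^ Suc k) n) sums shift_op Q b n"
      by (simp add: has_sum_imp_sums flip: lookup_mult_shift_op)
    \<comment> \<open>\<open>Q\<close> moves the series on by one power; the term restored here is
      that of \<open>Q ^ 0 = 1\<close>.\<close>
    then have "(\<lambda>k. lcoeff (Q ^ k) n) sums (shift_op Q b n + lcoeff 1 n)"
      by (subst (asm) sums_Suc_iff) simp
    with has_sum_imp_sums[OF b[of n]] have "b n = shift_op Q b n + lcoeff 1 n"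
      by (rule sums_unique2)
    then show "shift_op (1 - Q) b n = lcoeff 1 n"
      by (simp add: shift_op_diff)
  qed
  ultimately show ?thesis using s that by blast
qed

section \<open>Conjugation on the torus and inversion of a nonvanishing Laurent polynomial\<close>

definition lconj :: "((int ^ 'd) \<Rightarrow>\<^sub>0 complex) \<Rightarrow> ((int ^ 'd) \<Rightarrow>\<^sub>0 complex)" where
  "lconj p = (\<Sum>m\<in>lsupp p. lmonom (- m) (cnj (lcoeff p m)))"

text \<open>On the torus both \<open>mono_pow z (- m)\<close> and the conjugate of
  \<open>mono_pow z m\<close> are the inverse of \<open>mono_pow z m\<close>.\<close>

lemma leval_lconj:
  assumes z: "\<And>i. cmod (z $ i) = 1"
  shows "leval z (lconj p) = cnj (leval z p)"
proof -
  have "z $ i \<noteq> 0" for i using z by (metis norm_zero zero_neq_one)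
  then have "mono_pow z (- m) * mono_pow z m = 1" for m
    using mono_pow_add[of z "- m" m] by simp
  moreover have "cnj (mono_pow z m) * mono_pow z m = 1" for m
    using norm_mono_pow_torus[OF z, of m] by (metis complex_norm_square mult.commute of_real_1 power_one)
  ultimately have "mono_pow z (- m) = cnj (mono_pow z m)" for m
    by (metis mult_cancel_right mult_zero_right zero_neq_one)
  then show ?thesis
    by (simp add: lconj_def leval_sum leval_def[of z p])
qed

lemma compact_torus: "compact {z :: complex ^ 'd::finite. \<forall>i. cmod (z $ i) = 1}"
proof (rule compact_eq_bounded_closed[THEN iffD2], intro conjI)
  show "closed {z :: complex ^ 'd. \<forall>i. cmod (z $ i) = 1}"
    by (intro closed_Collect_all closed_Collect_eq continuous_intros)
  have "norm z \<le> real CARD('d)" if "\<forall>i. cmod (z $ i) = 1" for z :: "complex ^ 'd"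
  proof -
    have "norm z \<le> (\<Sum>i\<in>UNIV. norm (z $ i))"
      unfolding norm_vec_def by (rule L2_set_le_sum) auto
    then show ?thesis using that by simp
  qed
  then show "bounded {z :: complex ^ 'd. \<forall>i. cmod (z $ i) = 1}"
    by (intro boundedI) auto
qed

text \<open>A version of Wiener's lemma in which the inverse even decays exponentially.\<close>

lemma laurent_inverse:
  fixes P :: "(int ^ 'd::finite) \<Rightarrow>\<^sub>0 complex"
  assumes nz: "\<And>z. (\<And>i. cmod (z $ i) = 1) \<Longrightarrow> leval z P \<noteq> 0"
  obtains s g where "1 < s" "wsummable s g" "shift_op P g = lcoeff 1"
proof -
  define T where "T = {z :: complex ^ 'd. \<forall>i. cmod (z $ i) = 1}"
  define f where "f z = (cmod (leval z P))\<^sup>2" for z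
  have "z $ i \<noteq> 0" if "z \<in> T" for z i
    using that by (metis (mono_tags) T_def mem_Collect_eq norm_zero zero_neq_one)
  then have cont: "continuous_on T f"
    unfolding f_def leval_def mono_pow_def by (intro continuous_intros) auto
  have T: "compact T" "T \<noteq> {}"
    using compact_torus by (auto simp: T_def intro!: exI[of _ "\<chi> i. 1"])
  obtain z0 where z0: "z0 \<in> T" "\<And>z. z \<in> T \<Longrightarrow> f z0 \<le> f z"
    using continuous_attains_inf[OF T cont] by auto
  obtain z1 where z1: "z1 \<in> T" "\<And>z. z \<in> T \<Longrightarrow> f z \<le> f z1"
    using continuous_attains_sup[OF T cont] by auto
  have pos: "f z0 > 0" using nz z0(1) by (auto simp: f_def T_def)
  have pos1: "f z1 > 0" using pos z1(2)[OF z0(1)] by simp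
  \<comment> \<open>With this scaling, \<open>P * C\<close> takes real values between
    \<open>f z0 / f z1\<close> and 1 on the torus.\<close>
  define C where "C = lmonom 0 (of_real (1 / f z1)) * lconj P"
  define Q where "Q = 1 - P * C"
  \<comment> \<open>The maximum with \<open>1 / 2\<close> keeps \<open>q\<close> positive when
    \<open>f\<close> is constant on the torus.\<close>
  define q where "q = max (1 / 2) (1 - f z0 / f z1)"
  have q: "0 < q" "q < 1" using pos pos1 by (auto simp: q_def)
  have Q_le: "cmod (leval z Q) \<le> q" if z: "\<And>i. cmod (z $ i) = 1" for z
  proof -
    have nz: "z $ i \<noteq> 0" for i using z by (metis norm_zero zero_neq_one)
    have zT: "z \<in> T" using z by (simp add: T_def)
    have "leval z Q = 1 - of_real (1 / f z1) * (leval z P * cnj (leval z P))"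
      by (simp add: Q_def C_def leval_diff leval_mult[OF nz] leval_lconj[OF z])
    also have "\<dots> = of_real (1 - f z / f z1)"
      by (simp add: f_def flip: complex_norm_square)
    finally have "cmod (leval z Q) = \<bar>1 - f z / f z1\<bar>"
      by (metis norm_of_real)
    moreover have "f z / f z1 \<le> 1" "f z0 / f z1 \<le> f z / f z1"
      using z1(2)[OF zT] z0(2)[OF zT] pos1 by (auto simp: divide_right_mono)
    ultimately show ?thesis by (auto simp: q_def)
  qed
  obtain s b where "1 < s" "wsummable s b" "shift_op (1 - Q) b = lcoeff 1"
    using neumann_series[OF q Q_le] by blast
  moreover have "shift_op P (shift_op C b) = shift_op (1 - Q) b"
    by (simp add: Q_def shift_op_mult)
  ultimately show ?thesis
    using wsummable_shift_op[of s b C] by (intro that[of s "shift_op C b"]) auto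
qed

section \<open>Random series\<close>

text \<open>Makes measurability of parametrized integrals available for \<open>infsum\<close>. Both
  sides default to 0 without absolute convergence, so the equation is unconditional.\<close>

lemma infsum_eq_integral_count_space:
  fixes f :: "'i \<Rightarrow> complex"
  shows "(\<Sum>\<^sub>\<infinity>i. f i) = (\<integral>i. f i \<partial>count_space UNIV)"
proof (cases "integrable (count_space UNIV) f")
  case True
  then have "Infinite_Set_Sum.abs_summable_on f UNIV"
    by (simp add: Infinite_Set_Sum.abs_summable_on_def)
  then show ?thesis
    by (simp add: infsetsum_def flip: infsetsum_infsum)
next
  case False
  then have "\<not> f summable_on UNIV"
    by (simp add: summable_on_iff_abs_summable_on_complex abs_summable_equivalent
        Infinite_Set_Sum.abs_summable_on_def)
  then show ?thesis
    using False by (simp add: infsum_not_exists not_integrable_integral_eq)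
qed

lemma measurable_pair_count_space:
  fixes f :: "'i::countable \<Rightarrow> 'w \<Rightarrow> 'a"
  assumes [measurable]: "\<And>i. f i \<in> measurable M N"
  shows "(\<lambda>(\<omega>, i). f i \<omega>) \<in> measurable (M \<Otimes>\<^sub>M count_space UNIV) N"
  unfolding case_prod_beta' by (rule measurable_compose_countable'[where I = UNIV]) auto

lemma borel_measurable_infsum_complex:
  fixes f :: "'i::countable \<Rightarrow> 'w \<Rightarrow> complex"
  assumes "\<And>i. f i \<in> borel_measurable M"
  shows "(\<lambda>\<omega>. \<Sum>\<^sub>\<infinity>i. f i \<omega>) \<in> borel_measurable M"
  unfolding infsum_eq_integral_count_space using assms
  by (intro sigma_finite_measure.borel_measurable_lebesgue_integral
      sigma_finite_measure_count_space measurable_pair_count_space)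

text \<open>Taking logarithms confines the exceedances to an \<open>l1\<close> ball of radius
  \<open>log_plus a / ln s\<close>. Its polynomial cardinality is where the power
  \<open>CARD('d)\<close> in the moment condition comes from.\<close>

lemma card_exceedances_le:
  assumes s: "1 < s"
  shows "finite {k :: int ^ 'd::finite. s ^ l1 k < a}"
    and "real (card {k :: int ^ 'd. s ^ l1 k < a}) \<le> (2 * (log_plus a / ln s) + 1) ^ CARD('d)"
proof -
  define m where "m = nat \<lfloor>log_plus a / ln s\<rfloor>"
  have nonneg: "log_plus a / ln s \<ge> 0" using s by (auto simp: log_plus_def)
  have sub: "{k :: int ^ 'd. s ^ l1 k < a} \<subseteq> {k. l1 k \<le> m}"
  proof clarify
    fix k :: "int ^ 'd" assume k: "s ^ l1 k < a"
    have "0 < s ^ l1 k" using s by simp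
    with k have "ln (s ^ l1 k) < ln a" and "a > 0" by auto
    then have "real (l1 k) * ln s \<le> log_plus a"
      using s by (auto simp: ln_realpow log_plus_def)
    then have "real (l1 k) \<le> log_plus a / ln s"
      using s by (simp add: field_simps)
    then show "l1 k \<le> m" unfolding m_def by linarith
  qed
  show "finite {k :: int ^ 'd. s ^ l1 k < a}"
    by (rule finite_subset[OF sub finite_l1_ball])
  have "card {k :: int ^ 'd. s ^ l1 k < a} \<le> (2 * m + 1) ^ CARD('d)"
    using card_mono[OF finite_l1_ball sub] card_l1_ball[where 'd='d, of m] by linarith
  then have "real (card {k :: int ^ 'd. s ^ l1 k < a}) \<le> (2 * real m + 1) ^ CARD('d)"
    by (metis (mono_tags) of_nat_1 of_nat_add of_nat_le_iff of_nat_mult of_nat_numeral of_nat_power)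
  also have "\<dots> \<le> (2 * (log_plus a / ln s) + 1) ^ CARD('d)"
    using nonneg by (intro power_mono add_mono mult_left_mono) (auto simp: m_def)
  finally show "real (card {k :: int ^ 'd. s ^ l1 k < a}) \<le> \<dots>" .
qed

text \<open>Reduces the count of exceedances to the single power of \<open>log_plus\<close> whose
  expectation is assumed finite.\<close>

lemma power_add_1_le:
  fixes x :: real
  assumes "0 \<le> x"
  shows "(x + 1) ^ d \<le> 2 ^ d * (x ^ d + 1)"
proof -
  have "(x + 1) ^ d \<le> (2 * max x 1) ^ d"
    using assms by (intro power_mono) auto
  also have "\<dots> = 2 ^ d * max x 1 ^ d"
    by (rule power_mult_distrib)
  also have "max x 1 ^ d \<le> x ^ d + 1"
    using assms by (auto simp: max_def)
  finally show ?thesis by simp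
qed

text \<open>Borel--Cantelli in the form of Tonelli's theorem: the expected number of indices \<open>k\<close> with
  \<open>\<bar>Z\<^bsub>t - k\<^esub>\<bar> > s ^ l1 k\<close> does not change if every \<open>Z\<^bsub>t - k\<^esub>\<close> is replaced by \<open>Z\<^sub>0\<close>.\<close>

lemma AE_finite_exceedances:
  fixes Z :: "int ^ 'd::finite \<Rightarrow> 'w \<Rightarrow> complex"
  assumes M: "prob_space M"
    and Z [measurable]: "\<And>t. Z t \<in> borel_measurable M"
    and distr: "\<And>t. distr M borel (Z t) = distr M borel (Z 0)"
    and int: "integrable M (\<lambda>\<omega>. log_plus (cmod (Z 0 \<omega>)) ^ CARD('d))"
    and s: "1 < s"
  shows "AE \<omega> in M. finite {k. s ^ l1 k < cmod (Z (t - k) \<omega>)}"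
proof -
  interpret prob_space M by fact
  define A where "A k = {x :: complex. s ^ l1 k < cmod x}" for k :: "int ^ 'd"
  have [measurable]: "A k \<in> sets borel" for k
    unfolding A_def by measurable
  define L where "L \<omega> = log_plus (cmod (Z 0 \<omega>))" for \<omega>
  have L: "L \<omega> \<ge> 0" for \<omega> by (simp add: L_def log_plus_def)
  \<comment> \<open>The integral of the indicators is the number of exceedances, which is infinite
    exactly when the set is infinite.\<close>
  have count: "(\<integral>\<^sup>+k. indicator (A k) (x k) \<partial>count_space UNIV) = emeasure (count_space UNIV) {k. s ^ l1 k < cmod (x k)}"
    for x :: "int ^ 'd \<Rightarrow> complex"
  proof -
    have "(\<integral>\<^sup>+k. indicator (A k) (x k) \<partial>count_space UNIV)
        = (\<integral>\<^sup>+k. indicator {k. s ^ l1 k < cmod (x k)} k \<partial>count_space UNIV)"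
      by (intro nn_integral_cong) (auto simp: A_def indicator_def)
    also have "\<dots> = emeasure (count_space UNIV) {k. s ^ l1 k < cmod (x k)}"
      by (rule nn_integral_indicator) auto
    finally show ?thesis .
  qed
  have "(\<integral>\<^sup>+\<omega>. \<integral>\<^sup>+k. indicator (A k) (Z (t - k) \<omega>) \<partial>count_space UNIV \<partial>M)
      = (\<integral>\<^sup>+k. \<integral>\<^sup>+\<omega>. indicator (A k) (Z (t - k) \<omega>) \<partial>M \<partial>count_space UNIV)"
    by (rule nn_integral_count_space_nn_integral) auto
  also have "\<dots> = (\<integral>\<^sup>+k. \<integral>\<^sup>+x. indicator (A k) x \<partial>distr M borel (Z (t - k)) \<partial>count_space UNIV)"
    by (subst nn_integral_distr) auto
  also have "\<dots> = (\<integral>\<^sup>+k. \<integral>\<^sup>+x. indicator (A k) x \<partial>distr M borel (Z 0) \<partial>count_space UNIV)"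
    unfolding distr[of "t - k" for k] ..
  also have "\<dots> = (\<integral>\<^sup>+k. \<integral>\<^sup>+\<omega>. indicator (A k) (Z 0 \<omega>) \<partial>M \<partial>count_space UNIV)"
    by (subst nn_integral_distr) auto
  also have "\<dots> = (\<integral>\<^sup>+\<omega>. \<integral>\<^sup>+k. indicator (A k) (Z 0 \<omega>) \<partial>count_space UNIV \<partial>M)"
    by (rule nn_integral_count_space_nn_integral[symmetric]) auto
  also have "\<dots> \<le> (\<integral>\<^sup>+\<omega>. ennreal (2 ^ CARD('d) * ((2 / ln s) ^ CARD('d) * L \<omega> ^ CARD('d) + 1)) \<partial>M)"
  proof (rule nn_integral_mono)
    fix \<omega>
    have "real (card {k :: int ^ 'd. s ^ l1 k < cmod (Z 0 \<omega>)}) \<le> (2 * (L \<omega> / ln s) + 1) ^ CARD('d)"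
      unfolding L_def by (rule card_exceedances_le(2)[OF s])
    also have "\<dots> \<le> 2 ^ CARD('d) * ((2 * (L \<omega> / ln s)) ^ CARD('d) + 1)"
      using L[of \<omega>] s by (intro power_add_1_le) auto
    also have "(2 * (L \<omega> / ln s)) ^ CARD('d) = (2 / ln s) ^ CARD('d) * L \<omega> ^ CARD('d)"
      by (simp flip: power_mult_distrib)
    finally have "ennreal (real (card {k :: int ^ 'd. s ^ l1 k < cmod (Z 0 \<omega>)}))
      \<le> ennreal (2 ^ CARD('d) * ((2 / ln s) ^ CARD('d) * L \<omega> ^ CARD('d) + 1))"
      by (rule ennreal_leI)
    then show "(\<integral>\<^sup>+k. indicator (A k) (Z 0 \<omega>) \<partial>count_space UNIV)
        \<le> ennreal (2 ^ CARD('d) * ((2 / ln s) ^ CARD('d) * L \<omega> ^ CARD('d) + 1))"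
      unfolding count
      by (subst emeasure_count_space_finite) (auto simp: card_exceedances_le(1)[OF s] ennreal_of_nat_eq_real_of_nat)
  qed
  also have "\<dots> < \<infinity>"
  proof -
    have "integrable M (\<lambda>\<omega>. 2 ^ CARD('d) * ((2 / ln s) ^ CARD('d) * L \<omega> ^ CARD('d) + 1))"
      using int unfolding L_def by (intro integrable_mult_right integrable_add) auto
    then show ?thesis
      using L s by (subst (asm) integrable_iff_bounded) auto
  qed
  finally have "AE \<omega> in M. (\<integral>\<^sup>+k. indicator (A k) (Z (t - k) \<omega>) \<partial>count_space UNIV) \<noteq> \<infinity>"
    by (intro nn_integral_noteq_infinite sigma_finite_measure.borel_measurable_nn_integral
        sigma_finite_measure_count_space measurable_pair_count_space) auto
  then show ?thesis
    unfolding count by eventually_elim (auto simp: emeasure_count_space split: if_splits)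
qed

section \<open>Absolute convergence and the convolution identity for series\<close>

lemma summable_on_of_finite_exceedances:
  assumes w: "wsummable s \<psi>" and fin: "finite {k. s ^ l1 k < cmod (x k)}"
  shows "(\<lambda>k. cmod (\<psi> k * x k)) summable_on UNIV"
proof -
  let ?F = "{k. s ^ l1 k < cmod (x k)}"
  \<comment> \<open>Off \<open>?F\<close> the weighted coefficients dominate the series; the
    finitely many terms on \<open>?F\<close> are harmless.\<close>
  have "(\<lambda>k. cmod (\<psi> k) * s ^ l1 k) summable_on (- ?F)"
    using w unfolding wsummable_def by (rule summable_on_subset_banach) auto
  then have "(\<lambda>k. cmod (\<psi> k * x k)) summable_on (- ?F)"
    by (rule summable_on_comparison_test) (auto simp: norm_mult not_less intro: mult_left_mono)
  then have "(\<lambda>k. cmod (\<psi> k * x k)) summable_on (?F \<union> - ?F)"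
    using fin by (intro summable_on_Un_disjoint) auto
  then show ?thesis by simp
qed

text \<open>The translate by \<open>t\<close> is included because \<open>shift_op_series\<close>
  needs convergence at every site.\<close>

lemma summable_on_mono_pow:
  assumes w: "wsummable s \<psi>" and z: "\<And>i. 1 / s \<le> cmod (z $ i)" "\<And>i. cmod (z $ i) \<le> s" and s: "1 < s"
  shows "(\<lambda>k. \<psi> k * mono_pow z (k - t)) summable_on UNIV"
proof (rule abs_summable_summable, rule summable_on_comparison_test)
  show "(\<lambda>k. cmod (\<psi> k) * s ^ l1 k * s ^ l1 t) summable_on UNIV"
    using w unfolding wsummable_def by (rule summable_on_cmult_left)
  fix k
  have "cmod (mono_pow z (k - t)) \<le> s ^ l1 (k - t)"
    using norm_mono_pow_le[OF z] s by auto
  also have "\<dots> \<le> s ^ (l1 k + l1 t)"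
    using l1_triangle[of k "- t"] s by (intro power_increasing) auto
  finally show "cmod (\<psi> k * mono_pow z (k - t)) \<le> cmod (\<psi> k) * s ^ l1 k * s ^ l1 t"
    by (simp add: norm_mult power_add mult_left_mono mult.assoc)
qed auto

text \<open>Once \<open>P\<close> is moved onto the coefficients, they become those of
  \<open>Q\<close>, and the series reduces to a finite sum.\<close>

lemma shift_op_series:
  fixes \<psi> x :: "'g::ab_group_add \<Rightarrow> complex"
  assumes \<psi>: "shift_op P \<psi> = lcoeff Q"
    and sum: "\<And>t. (\<lambda>k. \<psi> k * x (t - k)) summable_on UNIV"
  shows "shift_op P (\<lambda>t. \<Sum>\<^sub>\<infinity>k. \<psi> k * x (t - k)) t = shift_op Q x t"
proof (rule has_sum_unique)
  show "((\<lambda>k. shift_op P \<psi> k * x (t - k)) has_sum shift_op P (\<lambda>t. \<Sum>\<^sub>\<infinity>k. \<psi> k * x (t - k)) t) UNIV"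
    by (intro has_sum_shift_op has_sum_infsum sum)
  show "((\<lambda>k. shift_op P \<psi> k * x (t - k)) has_sum shift_op Q x t) UNIV"
    unfolding \<psi> by (rule has_sum_coeff)
qed

lemma leval_series:
  assumes \<psi>: "shift_op P \<psi> = lcoeff Q" and w: "wsummable s \<psi>"
    and z: "\<And>i. 1 / s \<le> cmod (z $ i)" "\<And>i. cmod (z $ i) \<le> s" and s: "1 < s"
  shows "leval z P * (\<Sum>\<^sub>\<infinity>k. \<psi> k * mono_pow z k) = leval z Q"
proof -
  have "1 / s > 0" using s by simp
  then have nz: "z $ i \<noteq> 0" for i
    using z(1)[of i] by auto
  define x where "x t = mono_pow z (- t)" for t
  have x: "x (t - k) = mono_pow z (k - t)" for t k by (simp add: x_def)
  \<comment> \<open>For a character the series at \<open>t\<close> is a multiple of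
    \<open>x t\<close>, so \<open>P\<close> acts on it through the factor
    \<open>leval z P\<close>.\<close>
  have "(\<Sum>\<^sub>\<infinity>k. \<psi> k * x (t - k)) = x t * (\<Sum>\<^sub>\<infinity>k. \<psi> k * mono_pow z k)" for t
    by (subst infsum_cmult_right'[symmetric], rule infsum_cong)
      (simp add: x_def mono_pow_add[OF nz, symmetric] mult.left_commute)
  then have "shift_op P (\<lambda>t. x t * (\<Sum>\<^sub>\<infinity>k. \<psi> k * mono_pow z k)) 0 = shift_op Q x 0"
    using shift_op_series[OF \<psi>, of x 0] summable_on_mono_pow[OF w z s] by (simp add: x)
  then show ?thesis
    by (simp add: shift_op_mult_right leval_eq_shift_op[OF nz] x_def[abs_def])
qed

section \<open>Laurent expansion on a polyannulus and solution of the ARMA equation\<close>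

theorem proposition2p4:
  fixes R S :: "(int ^ 'd::finite) set"
    and \<phi> \<theta> :: "int ^ 'd \<Rightarrow> complex"
    and M :: "'w measure"
    and Z :: "int ^ 'd \<Rightarrow> 'w \<Rightarrow> complex"
  assumes "finite R" and "0 \<notin> R"
    and "finite S" and "0 \<notin> S"
    and "prob_space M"
    and "iid_field M Z"
    and "\<And>t :: real ^ 'd. ar_poly R \<phi> (exp_neg_i t) \<noteq> 0"
  shows "\<exists>(r :: real ^ 'd) (\<rho> :: real ^ 'd) \<psi>.
           (\<forall>i. 0 \<le> r $ i \<and> r $ i < 1 \<and> 1 < \<rho> $ i) \<and>
           quotient_laurent_on (polyannulus r \<rho>) (ma_poly S \<theta>) (ar_poly R \<phi>) \<psi> \<and>
           (integrable M (\<lambda>\<omega>. log_plus (cmod (Z 0 \<omega>)) ^ CARD('d)) \<longrightarrow>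
              (\<forall>t. AE \<omega> in M. (\<lambda>k. cmod (\<psi> k * Z (t - k) \<omega>)) summable_on UNIV) \<and>
              arma_solution M R \<phi> S \<theta> Z (linear_field \<psi> Z))"
proof -
  interpret prob_space M by fact
  define \<Phi> where "\<Phi> = 1 - (\<Sum>n\<in>R. lmonom n (\<phi> n))"
  define \<Theta> where "\<Theta> = 1 + (\<Sum>n\<in>S. lmonom n (\<theta> n))"
  have \<Phi>_eval: "leval z \<Phi> = ar_poly R \<phi> z" and \<Theta>_eval: "leval z \<Theta> = ma_poly S \<theta> z" for z
    by (simp_all add: \<Phi>_def \<Theta>_def ar_poly_def ma_poly_def leval_diff leval_add leval_sum)
  have nz: "leval z \<Phi> \<noteq> 0" if z: "\<And>i. cmod (z $ i) = 1" for z
  proof -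
    \<comment> \<open>The angles are \<open>- Arg (z $ i)\<close>, to cancel the minus sign in
      \<open>exp_neg_i\<close>.\<close>
    have "z $ i = exp (- \<i> * of_real (- Arg (z $ i)))" for i
      using rcis_cmod_Arg[of "z $ i"] z[of i] by (simp add: rcis_def cis_conv_exp)
    then have "z = exp_neg_i (\<chi> i. - Arg (z $ i))"
      by (simp add: exp_neg_i_def vec_eq_iff)
    then show ?thesis
      using assms(7)[of "\<chi> i. - Arg (z $ i)"] by (simp add: \<Phi>_eval)
  qed
  obtain s g where s: "1 < s" and wg: "wsummable s g" and g: "shift_op \<Phi> g = lcoeff 1"
    using laurent_inverse[OF nz] by blast
  define \<psi> where "\<psi> = shift_op \<Theta> g"
  have w\<psi>: "wsummable s \<psi>"
    unfolding \<psi>_def using s wg by (intro wsummable_shift_op) auto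
  have \<psi>: "shift_op \<Phi> \<psi> = lcoeff \<Theta>"
  proof -
    \<comment> \<open>The ring is commutative, so \<Phi> can act on \<open>g\<close> first and turn
      it into the unit.\<close>
    have "shift_op \<Phi> \<psi> = shift_op (\<Theta> * \<Phi>) g"
      by (simp add: \<psi>_def mult.commute[of \<Theta>] flip: shift_op_mult)
    also have "\<dots> = lcoeff (\<Theta> * 1)"
      by (simp only: shift_op_mult g lookup_mult_shift_op)
    finally show ?thesis by simp
  qed
  define r :: "real ^ 'd" where "r = (\<chi> i. 1 / s)"
  define \<rho> :: "real ^ 'd" where "\<rho> = (\<chi> i. s)"

  have laurent: "quotient_laurent_on (polyannulus r \<rho>) (ma_poly S \<theta>) (ar_poly R \<phi>) \<psi>"
    unfolding quotient_laurent_on_def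
  proof (intro ballI conjI)
    fix z assume "z \<in> polyannulus r \<rho>"
    then have z: "1 / s \<le> cmod (z $ i)" "cmod (z $ i) \<le> s" for i
      by (auto simp: polyannulus_def r_def \<rho>_def less_imp_le)
    \<comment> \<open>The series of \<open>g\<close> multiplied by the value of \<Phi> gives 1
      throughout the polyannulus, which excludes zeros off the torus too.\<close>
    show nz: "ar_poly R \<phi> z \<noteq> 0"
      using leval_series[OF g wg z s] by (auto simp: \<Phi>_eval)
    have "((\<lambda>k. \<psi> k * mono_pow z k) has_sum (\<Sum>\<^sub>\<infinity>k. \<psi> k * mono_pow z k)) UNIV"
      using has_sum_infsum[OF summable_on_mono_pow[OF w\<psi> z s, of 0]] by simp
    moreover have "(\<Sum>\<^sub>\<infinity>k. \<psi> k * mono_pow z k) = ma_poly S \<theta> z / ar_poly R \<phi> z"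
      using leval_series[OF \<psi> w\<psi> z s] nz by (simp add: \<Phi>_eval \<Theta>_eval nonzero_eq_divide_eq mult.commute)
    ultimately show "((\<lambda>k. \<psi> k * mono_pow z k) has_sum (ma_poly S \<theta> z / ar_poly R \<phi> z)) UNIV"
      by simp
  qed

  have Z: "Z t \<in> borel_measurable M" for t
    using assms(6) unfolding iid_field_def indep_vars_def by blast
  have distr: "distr M borel (Z t) = distr M borel (Z 0)" for t
    using assms(6) unfolding iid_field_def by blast

  have AE_summable: "AE \<omega> in M. (\<lambda>k. cmod (\<psi> k * Z (t - k) \<omega>)) summable_on UNIV"
    if "integrable M (\<lambda>\<omega>. log_plus (cmod (Z 0 \<omega>)) ^ CARD('d))" for t
    using AE_finite_exceedances[where Z = Z, OF assms(5) Z distr that s, of t]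
    by eventually_elim (rule summable_on_of_finite_exceedances[OF w\<psi>])

  have solution: "arma_solution M R \<phi> S \<theta> Z (linear_field \<psi> Z)"
    if int: "integrable M (\<lambda>\<omega>. log_plus (cmod (Z 0 \<omega>)) ^ CARD('d))"
    unfolding arma_solution_def
  proof (intro conjI allI)
    show "linear_field \<psi> Z t \<in> borel_measurable M" for t
      unfolding linear_field_def[abs_def]
      by (intro borel_measurable_infsum_complex borel_measurable_times borel_measurable_const Z)
    fix t
    \<comment> \<open>The equation at \<open>t\<close> also involves the sites \<open>t - n\<close>;
      as the lattice is countable, one null set serves all sites.\<close>
    have "AE \<omega> in M. \<forall>u. (\<lambda>k. cmod (\<psi> k * Z (u - k) \<omega>)) summable_on UNIV"
      unfolding AE_all_countable by (intro allI AE_summable int)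
    then show "AE \<omega> in M. linear_field \<psi> Z t \<omega> - (\<Sum>n\<in>R. \<phi> n * linear_field \<psi> Z (t - n) \<omega>)
        = Z t \<omega> + (\<Sum>n\<in>S. \<theta> n * Z (t - n) \<omega>)"
    proof eventually_elim
      case (elim \<omega>)
      then have "shift_op \<Phi> (\<lambda>t. linear_field \<psi> Z t \<omega>) t = shift_op \<Theta> (\<lambda>t. Z t \<omega>) t"
        unfolding linear_field_def
        by (intro shift_op_series[OF \<psi>]) (blast intro: abs_summable_summable)
      then show ?case
        by (simp add: \<Phi>_def \<Theta>_def shift_op_diff shift_op_add shift_op_sum)
    qed
  qed

  show ?thesis
  proof (intro exI conjI impI allI)
    show "0 \<le> r $ i" "r $ i < 1" "1 < \<rho> $ i" for i
      using s by (simp_all add: r_def \<rho>_def)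
    show "quotient_laurent_on (polyannulus r \<rho>) (ma_poly S \<theta>) (ar_poly R \<phi>) \<psi>"
      by (rule laurent)
  qed (erule AE_summable solution)+
qed

end
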